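(* Let $X$ be a complex Banach space and let $T\in\mathcal{B}(X)$. If every connected component $G$ of $\rho_{desc}(T)$ satisfies $G\cap\rho(T)\neq\emptyset$, then $$\sigma_{desc}(T)=\sigma_{desc}(T,\mathcal{B}(X)).$$
   Context: $\mathcal{B}(X)$ is the Banach algebra of all bounded linear operators on $X$. For $T\in\mathcal{B}(X)$, $\rho(T)$ is the resolvent set. For a linear operator $S$ on a vector space, with range $R(S)$, the descent is $d(S)=\min\{q\ge 0: R(S^q)=R(S^{q+1})\}$, with $d(S)=\infty$ if no such $q$ exists. The descent spectrum of $T$ as an operator is $\sigma_{desc}(T)=\{\lambda\in\mathbb{C}: d(\lambda-T)=\infty\}$, and $\rho_{desc}(T)=\mathbb{C}\setminus\sigma_{desc}(T)$. The descent spectrum of $T$ as an element of the algebra $\mathcal{B}(X)$ is $\sigma_{desc}(T,\mathcal{B}(X))=\{\lambda\in\mathbb{C}: d(L_{T-\lambda})=\infty\}$, where for $A\in\mathcal{B}(X)$ the operator $L_A:\mathcal{B}(X)\to\mathcal{B}(X)$ is left multiplication, $L_A(S)=AS$. *)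

theory Defs
  imports "HOL-Analysis.Analysis" "HOL-Library.Extended_Nat"
begin

text \<open>
  The library has only real Banach spaces.  A complex Banach space is a real one whose scalar
  multiplication is extended to the complex numbers, with norm homogeneous over them.
\<close>

class complex_banach = banach +
  fixes scaleC :: "complex \<Rightarrow> 'a \<Rightarrow> 'a"  (infixr "*\<^sub>C" 75)
  assumes scaleC_add_right: "a *\<^sub>C (x + y) = a *\<^sub>C x + a *\<^sub>C y"
    and scaleC_add_left: "(a + b) *\<^sub>C x = a *\<^sub>C x + b *\<^sub>C x"
    and scaleC_scaleC: "a *\<^sub>C (b *\<^sub>C x) = (a * b) *\<^sub>C x"
    and scaleC_of_real: "complex_of_real r *\<^sub>C x = r *\<^sub>R x"
    and norm_scaleC: "norm (a *\<^sub>C x) = cmod a * norm x"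

instantiation complex :: complex_banach
begin

definition scaleC_complex :: "complex \<Rightarrow> complex \<Rightarrow> complex"
  where "scaleC_complex a x = a * x"

instance
  by standard
    (simp_all add: scaleC_complex_def algebra_simps norm_mult scaleR_conv_of_real)

end

text \<open>
  Elements of $\mathcal{B}(X)$ are represented as functions; multiplication in the algebra is
  composition.
\<close>

definition bounded_ops :: "('a::complex_banach \<Rightarrow> 'a) set"
  where "bounded_ops = {T. bounded_linear T \<and> (\<forall>c x. T (c *\<^sub>C x) = c *\<^sub>C T x)}"

definition resolvent_set :: "('a::complex_banach \<Rightarrow> 'a) \<Rightarrow> complex set"
  where "resolvent_set T =
    {z. \<exists>S\<in>bounded_ops. S \<circ> (\<lambda>x. z *\<^sub>C x - T x) = id \<and> (\<lambda>x. z *\<^sub>C x - T x) \<circ> S = id}"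

text \<open>
  The vector space on which the operator acts is an explicit carrier \<open>V\<close>, so that the same notion
  applies to operators on $X$ (with \<open>V = UNIV\<close>) and to operators on $\mathcal{B}(X)$.
\<close>

definition descent :: "'v set \<Rightarrow> ('v \<Rightarrow> 'v) \<Rightarrow> enat"
  where "descent V S =
    (if \<exists>q. (S ^^ q) ` V = (S ^^ (q + 1)) ` V
     then enat (LEAST q. (S ^^ q) ` V = (S ^^ (q + 1)) ` V)
     else \<infinity>)"

definition desc_spectrum :: "('a::complex_banach \<Rightarrow> 'a) \<Rightarrow> complex set"
  where "desc_spectrum T = {z. descent UNIV (\<lambda>x. z *\<^sub>C x - T x) = \<infinity>}"

definition desc_resolvent :: "('a::complex_banach \<Rightarrow> 'a) \<Rightarrow> complex set"
  where "desc_resolvent T = - desc_spectrum T"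

definition left_mult :: "('a \<Rightarrow> 'a) \<Rightarrow> ('a \<Rightarrow> 'a) \<Rightarrow> ('a \<Rightarrow> 'a)"
  where "left_mult A = (\<lambda>S. A \<circ> S)"

definition alg_desc_spectrum :: "('a::complex_banach \<Rightarrow> 'a) \<Rightarrow> complex set"
  where "alg_desc_spectrum T =
    {z. descent bounded_ops (left_mult (\<lambda>x. T x - z *\<^sub>C x)) = \<infinity>}"

end

theory Submission
  imports Defs
begin

text \<open>
  Fix \<open>z\<close> at which \<open>A = T - z\<close> has finite descent \<open>q\<close>, so that \<open>A\<close> maps \<open>R(A ^^ q)\<close> onto itself. By the
  open mapping theorem the equation \<open>A ^^ (q + 1) y = A ^^ q x\<close> can be solved with \<open>norm y \<le> C * norm x\<close>.
  Iterating this solution shows a dichotomy: if \<open>N(A ^^ (q + 1)) = N(A ^^ q)\<close>, no \<open>w \<noteq> z\<close> near \<open>z\<close> is an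
  eigenvalue of \<open>T\<close>; otherwise a vector in \<open>N(A ^^ (q + 1)) - N(A ^^ q)\<close> is the constant term of a power
  series in \<open>w - z\<close> producing an eigenvector for every \<open>w\<close> near \<open>z\<close>. The two alternatives define disjoint open
  sets covering the descent resolvent set, so on a component meeting the resolvent set the first one holds
  throughout. There the kernels stabilise, \<open>X = R(A ^^ q) \<oplus> N(A ^^ q)\<close>, and inverting \<open>A\<close> on \<open>R(A ^^ q)\<close>
  gives a bounded \<open>S\<close> with \<open>A ^^ q = A ^^ (q + 1) S\<close>, i.e. finite descent of left multiplication by \<open>A\<close>.
\<close>

section \<open>Bounded selections from closed linear relations\<close>

text \<open>
  The open mapping theorem in a form for relations: it applies to \<open>Q y = P x\<close> below, where neither is \<open>y\<close>
  determined by \<open>x\<close> nor is the range of \<open>Q\<close> closed.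
\<close>

lemma closed_linear_relation_bounded_selection:
  fixes \<Gamma> :: "('a::banach \<times> 'b::banach) set"
  assumes closed: "closed \<Gamma>" and sub: "subspace \<Gamma>" and onto: "\<And>y. \<exists>x. (x, y) \<in> \<Gamma>"
  obtains C where "C > 0" "\<And>y. \<exists>x. (x, y) \<in> \<Gamma> \<and> norm x \<le> C * norm y"
proof -
  \<comment> \<open>The image under the relation of the ball of radius \<open>n\<close>. These sets
    cover the space, so by Baire's theorem the closure of one of them has interior.\<close>
  define E where "E n = {y. \<exists>x. (x, y) \<in> \<Gamma> \<and> norm x \<le> real n}" for n
  have add: "(x + x', y + y') \<in> \<Gamma>" if "(x, y) \<in> \<Gamma>" "(x', y') \<in> \<Gamma>" for x x' y y'
    using subspace_add[OF sub that] by simp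
  have diff: "(x - x', y - y') \<in> \<Gamma>" if "(x, y) \<in> \<Gamma>" "(x', y') \<in> \<Gamma>" for x x' y y'
    using subspace_diff[OF sub that] by simp
  have scale: "(t *\<^sub>R x, t *\<^sub>R y) \<in> \<Gamma>" if "(x, y) \<in> \<Gamma>" for t x y
    using subspace_scale[OF sub that, of t] by simp
  have zero: "(0, 0) \<in> \<Gamma>"
    using subspace_0[OF sub] by (simp add: zero_prod_def)
  have "(\<Union>n. closure (E n)) = UNIV"
  proof -
    have "y \<in> (\<Union>n. closure (E n))" for y
    proof -
      obtain x where "(x, y) \<in> \<Gamma>" using onto by blast
      moreover obtain n where "norm x \<le> real n" using real_arch_simple by blast
      ultimately have "y \<in> E n" by (auto simp: E_def)
      then show ?thesis using closure_subset by blast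
    qed
    then show ?thesis by blast
  qed
  moreover have "completely_metrizable_space (euclidean :: 'b topology)"
    by (rule completely_metrizable_space_euclidean)
  ultimately obtain n where "interior (closure (E n)) \<noteq> {}"
    using Baire_category_alt[of "euclidean :: 'b topology" "range (\<lambda>n. closure (E n))"]
    by force
  then obtain y0 r where r: "r > 0" "ball y0 r \<subseteq> closure (E n)"
    by (meson all_not_in_conv mem_interior)
  \<comment> \<open>Subtracting an approximation of \<open>y0\<close> from one of
    \<open>y0 + v\<close> recentres the ball at the origin, at the price of doubling the
    bound.\<close>
  have near: "\<exists>x y. (x, y) \<in> \<Gamma> \<and> norm x \<le> 2 * real n \<and> norm (v - y) < e"
    if v: "norm v < r" and e: "e > 0" for v e
  proof -
    have "y0 + v \<in> closure (E n)" "y0 \<in> closure (E n)"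
      using r v by (auto simp: subset_eq dist_norm)
    then obtain y1 y2 where y: "y1 \<in> E n" "dist y1 (y0 + v) < e / 2" "y2 \<in> E n" "dist y2 y0 < e / 2"
      using e by (meson closure_approachable half_gt_zero)
    then obtain x1 x2 where x: "(x1, y1) \<in> \<Gamma>" "norm x1 \<le> n" "(x2, y2) \<in> \<Gamma>" "norm x2 \<le> n"
      by (auto simp: E_def)
    have "norm (v - (y1 - y2)) = norm ((y2 - y0) - (y1 - (y0 + v)))"
      by (simp add: algebra_simps)
    also have "\<dots> < e"
      using y norm_triangle_ineq4[of "y2 - y0" "y1 - (y0 + v)"] by (simp add: dist_norm)
    finally have "norm (v - (y1 - y2)) < e" .
    moreover have "norm (x1 - x2) \<le> 2 * real n"
      using x norm_triangle_ineq4[of x1 x2] by simp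
    ultimately show ?thesis using diff x by blast
  qed
  \<comment> \<open>Scaling \<open>v\<close> to norm \<open>r / 2\<close> and approximating within
    \<open>r / 4\<close> leaves at most half of \<open>v\<close> after scaling back; the bound
    \<open>2 * real n\<close> then becomes \<open>4 * real n / r\<close> times
    \<open>norm v\<close>.\<close>
  define K where "K = 4 * real n / r"
  have K: "K \<ge> 0" using r by (simp add: K_def)
  have "\<exists>x y. (x, y) \<in> \<Gamma> \<and> norm x \<le> K * norm v \<and> norm (v - y) \<le> norm v / 2" for v
  proof (cases "v = 0")
    case True
    then show ?thesis using zero by force
  next
    case False
    define t where "t = r / (2 * norm v)"
    have t: "t > 0" using False r by (simp add: t_def)
    have "norm (t *\<^sub>R v) < r" using False r by (simp add: t_def)
    then obtain x y where xy: "(x, y) \<in> \<Gamma>" "norm x \<le> 2 * real n" "norm (t *\<^sub>R v - y) < r / 4"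
      using near[of "t *\<^sub>R v" "r / 4"] r by auto
    have "norm (x /\<^sub>R t) \<le> K * norm v"
      using xy(2) t r False by (simp add: t_def K_def field_simps)
    moreover have "norm (v - y /\<^sub>R t) \<le> norm v / 2"
    proof -
      have "v - y /\<^sub>R t = (t *\<^sub>R v - y) /\<^sub>R t" using t by (simp add: scaleR_diff_right)
      then have "norm (v - y /\<^sub>R t) = norm (t *\<^sub>R v - y) / t" using t by (simp add: divide_inverse mult.commute)
      also have "\<dots> \<le> (r / 4) / t" using xy(3) t by (intro divide_right_mono) auto
      also have "\<dots> = norm v / 2" using False r by (simp add: t_def)
      finally show ?thesis .
    qed
    ultimately show ?thesis using scale[OF xy(1)] by blast
  qed
  then obtain f g where fg: "\<And>v. (f v, g v) \<in> \<Gamma>" "\<And>v. norm (f v) \<le> K * norm v"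
      "\<And>v. norm (v - g v) \<le> norm v / 2"
    by metis
  \<comment> \<open>The summand 1 keeps the constant positive even when
    \<open>K = 0\<close>.\<close>
  have "\<exists>x. (x, v) \<in> \<Gamma> \<and> norm x \<le> (2 * K + 1) * norm v" for v
  proof -
    \<comment> \<open>What is left of \<open>v\<close> after \<open>k\<close> corrections. It halves
      each time, so the preimages \<open>f (w k)\<close> are summable, and closedness puts the limit
      of the partial sums into the relation.\<close>
    define w where "w k = ((\<lambda>u. u - g u) ^^ k) v" for k
    have w_Suc: "w (Suc k) = w k - g (w k)" and w_0: "w 0 = v" for k
      by (simp_all add: w_def)
    have w: "norm (w k) \<le> norm v * (1/2) ^ k" for k
    proof (induction k)
      case (Suc k)
      then show ?case using fg(3)[of "w k"] by (simp add: w_Suc)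
    qed (simp add: w_0)
    have "(\<lambda>k. (1/2) ^ k) sums (1 / (1 - 1/2 :: real))" by (intro geometric_sums) simp
    then have geo: "(\<lambda>k. K * norm v * (1/2) ^ k) sums (2 * K * norm v)"
      using sums_mult[of "\<lambda>k. (1/2) ^ k" 2 "K * norm v"] by (simp add: algebra_simps)
    have bd: "norm (f (w k)) \<le> K * norm v * (1/2) ^ k" for k
      using fg(2)[of "w k"] mult_left_mono[OF w K] by (metis mult.assoc order_trans)
    have sm: "summable (\<lambda>k. norm (f (w k)))"
      by (rule summable_comparison_test'[OF sums_summable[OF geo]]) (use bd in simp)
    define x where "x = (\<Sum>k. f (w k))"
    have "norm x \<le> (\<Sum>k. norm (f (w k)))"
      unfolding x_def by (rule summable_norm[OF sm])
    also have "\<dots> \<le> 2 * K * norm v"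
      using suminf_le[OF bd sm sums_summable[OF geo]] sums_unique[OF geo] by simp
    finally have "norm x \<le> (2 * K + 1) * norm v" by (simp add: algebra_simps add_increasing)
    moreover have "(x, v) \<in> \<Gamma>"
    proof -
      have in\<Gamma>: "(\<Sum>k<m. f (w k), v - w m) \<in> \<Gamma>" for m
      proof (induction m)
        case (Suc m)
        then show ?case using add[OF Suc fg(1)[of "w m"]] by (simp add: w_Suc algebra_simps)
      qed (simp add: w_0 zero)
      have "w \<longlonglongrightarrow> 0"
      proof (rule Lim_null_comparison)
        show "(\<lambda>k. norm v * (1/2) ^ k) \<longlonglongrightarrow> 0"
          by (intro tendsto_mult_right_zero LIMSEQ_power_zero) simp
      qed (use w in simp)
      then have "(\<lambda>m. v - w m) \<longlonglongrightarrow> v - 0" by (intro tendsto_intros)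
      moreover have "(\<lambda>m. \<Sum>k<m. f (w k)) \<longlonglongrightarrow> x"
        unfolding x_def by (rule summable_LIMSEQ[OF summable_norm_cancel[OF sm]])
      ultimately have "(\<lambda>m. (\<Sum>k<m. f (w k), v - w m)) \<longlonglongrightarrow> (x, v)"
        by (auto intro: tendsto_Pair)
      then show ?thesis by (rule closed_sequentially[OF closed in\<Gamma>])
    qed
    ultimately show ?thesis by blast
  qed
  moreover have "2 * K + 1 > 0" using K by simp
  ultimately show ?thesis using that by blast
qed

text \<open>The pairs with \<open>Q y = P x\<close> form a subspace, closed by continuity, and the
  range inclusion provides a \<open>y\<close> for every \<open>x\<close>. The selected
  \<open>y\<close> need not be linear or continuous in \<open>x\<close>; later arguments use only
  the norm bound.\<close>

lemma range_subset_bounded_selection: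
  fixes P :: "'a::banach \<Rightarrow> 'c::real_normed_vector" and Q :: "'b::banach \<Rightarrow> 'c"
  assumes P: "bounded_linear P" and Q: "bounded_linear Q" and PQ: "range P \<subseteq> range Q"
  obtains C where "C > 0" "\<And>x. \<exists>y. Q y = P x \<and> norm y \<le> C * norm x"
proof -
  define \<Gamma> where "\<Gamma> = {(y, x). Q y = P x}"
  interpret P: bounded_linear P by fact
  interpret Q: bounded_linear Q by fact
  have "\<Gamma> = {p. Q (fst p) = P (snd p)}" by (auto simp: \<Gamma>_def)
  then have "closed \<Gamma>"
    by (auto intro!: closed_Collect_eq continuous_intros P.continuous_on Q.continuous_on)
  moreover have "subspace \<Gamma>"
    by (auto simp: \<Gamma>_def subspace_def P.add Q.add P.scaleR Q.scaleR P.zero Q.zero zero_prod_def)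
  moreover have "\<exists>y. (y, x) \<in> \<Gamma>" for x
    using PQ by (auto simp: \<Gamma>_def) (metis rangeE rangeI subsetD)
  ultimately show ?thesis
    using closed_linear_relation_bounded_selection[of \<Gamma>] that by (auto simp: \<Gamma>_def)
qed

section \<open>Complex scalars and powers of bounded operators\<close>

lemma scaleC_one [simp]: "1 *\<^sub>C (x :: 'a::complex_banach) = x"
  by (metis of_real_1 scaleC_of_real scaleR_one)

lemma bounded_linear_scaleC: "bounded_linear (\<lambda>x :: 'a::complex_banach. c *\<^sub>C x)"
proof (rule bounded_linear_intro[where K = "cmod c"])
  show "c *\<^sub>C (r *\<^sub>R x) = r *\<^sub>R (c *\<^sub>C x)" for r and x :: 'a
    by (metis mult.commute scaleC_of_real scaleC_scaleC)
qed (simp_all add: scaleC_add_right norm_scaleC mult.commute)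

lemma scaleC_diff_left: "(a - b) *\<^sub>C (x :: 'a::complex_banach) = a *\<^sub>C x - b *\<^sub>C x"
  by (metis add_diff_cancel_right' diff_add_cancel scaleC_add_left)

lemma scaleC_eq_0_iff: "c *\<^sub>C (x :: 'a::complex_banach) = 0 \<longleftrightarrow> c = 0 \<or> x = 0"
  by (metis mult_eq_0_iff norm_eq_zero norm_scaleC)

lemma bounded_ops_funpow:
  assumes "A \<in> bounded_ops"
  shows "A ^^ n \<in> bounded_ops"
proof (induction n)
  case 0
  then show ?case by (simp add: bounded_ops_def bounded_linear_ident id_def)
next
  case (Suc n)
  then show ?case using assms
    by (auto simp: bounded_ops_def o_def intro: bounded_linear_compose)
qed

lemma shift_in_bounded_ops:
  assumes "T \<in> bounded_ops"
  shows "(\<lambda>x. T x - z *\<^sub>C x) \<in> bounded_ops"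
proof -
  have "c *\<^sub>C (T x - z *\<^sub>C x) = c *\<^sub>C T x - z *\<^sub>C c *\<^sub>C x" for c x
    using linear_diff[OF bounded_linear.linear[OF bounded_linear_scaleC]]
    by (metis mult.commute scaleC_scaleC)
  then show ?thesis
    using assms by (auto simp: bounded_ops_def intro: bounded_linear_sub bounded_linear_scaleC)
qed

text \<open>Reconciles the signs: \<open>desc_spectrum\<close> is built from \<open>z - T\<close>,
  \<open>alg_desc_spectrum\<close> from \<open>T - z\<close>. Powers of the two differ by a sign,
  which the range, being a subspace, absorbs.\<close>

lemma range_funpow_minus:
  fixes A :: "'a::real_vector \<Rightarrow> 'a"
  assumes "linear A"
  shows "range ((\<lambda>x. - A x) ^^ n) = range (A ^^ n)"
proof (induction n)
  case (Suc n)
  have "range ((\<lambda>x. - A x) ^^ Suc n) = (\<lambda>x. - A x) ` range ((\<lambda>x. - A x) ^^ n)"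
    by (simp add: image_comp o_def)
  also have "\<dots> = (\<lambda>x. - A ((A ^^ n) x)) ` UNIV"
    by (simp add: Suc image_comp o_def)
  also have "\<dots> = (\<lambda>x. A ((A ^^ n) (- x))) ` UNIV"
  proof -
    have "(A ^^ m) (- x) = - (A ^^ m) x" for m x
      by (induction m) (simp_all add: linear_neg[OF assms])
    then show ?thesis by (simp add: linear_neg[OF assms])
  qed
  also have "\<dots> = range (A ^^ Suc n)"
    by (metis (no_types, lifting) comp_apply funpow.simps(2) image_cong image_image surj_uminus)
  finally show ?case .
qed simp

section \<open>Stable ranges and kernels, and the right factor\<close>

lemma range_funpow_stable:
  fixes A :: "'a \<Rightarrow> 'a"
  assumes "range (A ^^ Suc q) = range (A ^^ q)"
  shows "range (A ^^ (n + q)) = range (A ^^ q)"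
proof (induction n)
  case (Suc n)
  have "range (A ^^ (Suc n + q)) = A ` range (A ^^ (n + q))"
    by (simp add: image_comp o_def)
  also have "\<dots> = range (A ^^ Suc q)"
    by (simp add: Suc image_comp o_def)
  finally show ?case using assms by simp
qed simp

lemma kernel_funpow_stable:
  fixes A :: "'a::zero \<Rightarrow> 'a"
  assumes "(A ^^ Suc q) -` {0} \<subseteq> (A ^^ q) -` {0}"
  shows "(A ^^ (n + q)) x = 0 \<Longrightarrow> (A ^^ q) x = 0"
proof (induction n arbitrary: x)
  case (Suc n)
  then have "(A ^^ (n + q)) (A x) = 0"
    by (simp add: funpow_swap1)
  then have "(A ^^ q) (A x) = 0" by (rule Suc.IH)
  then have "x \<in> (A ^^ Suc q) -` {0}" by (simp add: funpow_swap1)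
  then show ?case using assms by auto
qed simp

text \<open>Stability of ranges and kernels makes \<open>A\<close> bijective on the range of
  \<open>A ^^ q\<close>. There \<open>A ^^ Suc q\<close> can be inverted, and \<open>S\<close> is
  this inverse applied to \<open>(A ^^ q) x\<close>.\<close>

lemma bounded_right_factor:
  assumes A: "A \<in> bounded_ops"
    and ran: "range (A ^^ Suc q) = range (A ^^ q)"
    and ker: "(A ^^ Suc q) -` {0} \<subseteq> (A ^^ q) -` {0}"
  obtains S where "S \<in> bounded_ops" "A ^^ q = A ^^ Suc q \<circ> S"
proof -
  \<comment> \<open>The extra \<open>q\<close> factors keep \<open>S x\<close> inside the range of
    \<open>A ^^ q\<close>: solving with \<open>A ^^ m\<close> and applying \<open>A ^^ q\<close>
    leaves exactly \<open>A ^^ Suc q\<close> to apply.\<close>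
  define m where "m = Suc q + q"
  have P: "bounded_linear (A ^^ q)" "\<And>c x. (A ^^ q) (c *\<^sub>C x) = c *\<^sub>C (A ^^ q) x"
    using bounded_ops_funpow[OF A] by (auto simp: bounded_ops_def)
  have Q: "bounded_linear (A ^^ m)" "\<And>c x. (A ^^ m) (c *\<^sub>C x) = c *\<^sub>C (A ^^ m) x"
    using bounded_ops_funpow[OF A] by (auto simp: bounded_ops_def)
  interpret P: bounded_linear "A ^^ q" by (rule P)
  interpret Q: bounded_linear "A ^^ m" by (rule Q)
  have "range (A ^^ q) \<subseteq> range (A ^^ m)"
    using range_funpow_stable[OF ran, of "Suc q"] by (simp add: m_def del: funpow.simps)
  from range_subset_bounded_selection[OF P(1) Q(1) this]
  obtain C h where C: "C > 0" and h: "\<And>x. (A ^^ m) (h x) = (A ^^ q) x"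
      "\<And>x. norm (h x) \<le> C * norm x"
    by metis
  \<comment> \<open>\<open>h x\<close> is determined only modulo the kernel of \<open>A ^^ q\<close>, so \<open>(A ^^ q) (h x)\<close> depends linearly
    on \<open>x\<close> even though \<open>h\<close> need not.\<close>
  have eqI: "(A ^^ q) u = (A ^^ q) v" if "(A ^^ m) u = (A ^^ m) v" for u v
  proof -
    have "(A ^^ m) (u - v) = 0" using that by (simp add: Q.diff)
    then have "(A ^^ q) (u - v) = 0"
      unfolding m_def by (rule kernel_funpow_stable[OF ker])
    then show ?thesis by (simp add: P.diff)
  qed
  define S where "S x = (A ^^ q) (h x)" for x
  obtain B where B: "B > 0" "\<And>x. norm ((A ^^ q) x) \<le> norm x * B"
    using P.pos_bounded by blast
  have "bounded_linear S"
  proof (rule bounded_linear_intro[where K = "C * B"])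
    show "S (x + y) = S x + S y" for x y
      unfolding S_def P.add[symmetric] by (rule eqI) (simp add: Q.add P.add h)
    show "S (r *\<^sub>R x) = r *\<^sub>R S x" for r x
      unfolding S_def P.scaleR[symmetric] by (rule eqI) (simp add: Q.scaleR P.scaleR h)
    show "norm (S x) \<le> norm x * (C * B)" for x
      using order_trans[OF B(2) mult_right_mono[OF h(2)]] B(1)
      by (simp add: S_def algebra_simps)
  qed
  moreover have "S (c *\<^sub>C x) = c *\<^sub>C S x" for c x
    unfolding S_def P(2)[symmetric] by (rule eqI) (simp add: P(2) Q(2) h)
  moreover have "(A ^^ Suc q) (S x) = (A ^^ q) x" for x
    using h(1)[of x] unfolding S_def m_def by (simp only: funpow_add o_apply)
  ultimately show ?thesis
    using that[of S] by (auto simp: bounded_ops_def fun_eq_iff simp del: funpow.simps)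
qed

section \<open>Eigenvalues of small modulus\<close>

text \<open>Starting at an eigenvector \<open>z\<close>, each \<open>u (Suc n)\<close> is chosen so
  that \<open>A ^^ Suc q\<close> maps it to \<open>\<mu>\<close> times
  \<open>(A ^^ q) (u n)\<close>. Stable kernels keep \<open>(A ^^ q) (u n)\<close> equal to
  \<open>(A ^^ q) z\<close>, while the selection bound drives \<open>u n\<close> to 0 once
  \<open>C * cmod \<mu> < 1\<close>. Hence \<open>(A ^^ q) z\<close>, which is
  \<open>\<mu> ^ q\<close> times \<open>z\<close>, vanishes.\<close>

lemma no_small_eigenvalue:
  assumes A: "A \<in> bounded_ops"
    and ran: "range (A ^^ q) \<subseteq> range (A ^^ Suc q)"
    and ker: "(A ^^ Suc q) -` {0} \<subseteq> (A ^^ q) -` {0}"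
  obtains \<delta> where "\<delta> > 0"
    "\<And>\<mu> z. \<mu> \<noteq> 0 \<Longrightarrow> cmod \<mu> < \<delta> \<Longrightarrow> A z = \<mu> *\<^sub>C z \<Longrightarrow> z = 0"
proof -
  have P: "bounded_linear (A ^^ n)" "\<And>c x. (A ^^ n) (c *\<^sub>C x) = c *\<^sub>C (A ^^ n) x" for n
    using bounded_ops_funpow[OF A] by (auto simp: bounded_ops_def)
  have Ac: "A (c *\<^sub>C x) = c *\<^sub>C A x" for c x
    using A by (simp add: bounded_ops_def)
  interpret P: bounded_linear "A ^^ q" by (rule P)
  interpret Q: bounded_linear "A ^^ Suc q" by (rule P)
  obtain C h where C: "C > 0" and h: "\<And>x. (A ^^ Suc q) (h x) = (A ^^ q) x"
      "\<And>x. norm (h x) \<le> C * norm x"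
    using range_subset_bounded_selection[OF P(1) P(1) ran] by metis
  have "z = 0" if \<mu>: "\<mu> \<noteq> 0" "cmod \<mu> < 1 / C" and z: "A z = \<mu> *\<^sub>C z" for \<mu> z
  proof -
    define u where "u n = ((\<lambda>v. h (\<mu> *\<^sub>C v)) ^^ n) z" for n
    have u_Suc: "u (Suc n) = h (\<mu> *\<^sub>C u n)" and u_0: "u 0 = z" for n
      by (simp_all add: u_def)
    have "norm (u n) \<le> norm z * (C * cmod \<mu>) ^ n" for n
    proof (induction n)
      case (Suc n)
      have "norm (u (Suc n)) \<le> C * cmod \<mu> * norm (u n)"
        using h(2)[of "\<mu> *\<^sub>C u n"] by (simp add: u_Suc norm_scaleC mult.assoc)
      also have "\<dots> \<le> C * cmod \<mu> * (norm z * (C * cmod \<mu>) ^ n)"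
        using C by (intro mult_left_mono Suc) simp
      finally show ?case by (simp add: algebra_simps)
    qed (simp add: u_0)
    moreover have "(\<lambda>n. norm z * (C * cmod \<mu>) ^ n) \<longlonglongrightarrow> 0"
      using C \<mu> by (intro tendsto_mult_right_zero LIMSEQ_power_zero) (simp add: field_simps)
    ultimately have "u \<longlonglongrightarrow> 0"
      by (intro Lim_null_comparison[of u]) simp_all
    then have "(\<lambda>n. (A ^^ q) (u n)) \<longlonglongrightarrow> (A ^^ q) 0"
      by (rule P.tendsto)
    moreover have "(A ^^ q) (u n) = (A ^^ q) z" for n
    proof (induction n)
      case (Suc n)
      have "(A ^^ Suc q) (u (Suc n)) = \<mu> *\<^sub>C (A ^^ q) (u n)"
        unfolding u_Suc h P(2) ..
      also have "\<dots> = (A ^^ q) (A z)"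
        using Suc by (simp add: z P(2))
      finally have "(A ^^ Suc q) (u (Suc n) - z) = 0"
        by (simp add: Q.diff funpow_swap1 del: funpow.simps) (simp add: funpow_swap1)
      then have "(A ^^ q) (u (Suc n) - z) = 0" using ker by auto
      then show ?case by (simp add: P.diff)
    qed (simp add: u_0)
    ultimately have "(A ^^ q) z = 0"
      by (simp add: P.zero LIMSEQ_const_iff)
    moreover have "(A ^^ n) z = \<mu> ^ n *\<^sub>C z" for n
      by (induction n) (simp_all add: Ac z scaleC_scaleC mult.commute)
    ultimately show "z = 0" using \<mu>(1) by (simp add: scaleC_eq_0_iff)
  qed
  then show ?thesis using that[of "1 / C"] C by simp
qed

text \<open>With \<open>y 0 = x0\<close> and
  \<open>(A ^^ Suc q) (y (Suc k)) = (A ^^ q) (y k)\<close>, the series of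
  \<open>\<mu> ^ k *\<^sub>C y k\<close> sums to some \<open>z\<close>. Applying
  \<open>A ^^ Suc q\<close> kills the constant term and shifts the others, giving
  \<open>\<mu>\<close> times \<open>(A ^^ q) z\<close>.\<close>

lemma all_small_eigenvalues:
  assumes A: "A \<in> bounded_ops"
    and ran: "range (A ^^ q) \<subseteq> range (A ^^ Suc q)"
    and x0: "(A ^^ Suc q) x0 = 0" "(A ^^ q) x0 \<noteq> 0"
  obtains \<delta> where "\<delta> > 0" "\<And>\<mu>. cmod \<mu> < \<delta> \<Longrightarrow> \<exists>z. z \<noteq> 0 \<and> A z = \<mu> *\<^sub>C z"
proof -
  have P: "bounded_linear (A ^^ n)" "\<And>c x. (A ^^ n) (c *\<^sub>C x) = c *\<^sub>C (A ^^ n) x" for n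
    using bounded_ops_funpow[OF A] by (auto simp: bounded_ops_def)
  interpret P: bounded_linear "A ^^ q" by (rule P)
  interpret Q: bounded_linear "A ^^ Suc q" by (rule P)
  obtain C h where C: "C > 0" and h: "\<And>x. (A ^^ Suc q) (h x) = (A ^^ q) x"
      "\<And>x. norm (h x) \<le> C * norm x"
    using range_subset_bounded_selection[OF P(1) P(1) ran] by metis
  obtain B where B: "B > 0" "\<And>x. norm ((A ^^ q) x) \<le> norm x * B"
    using P.pos_bounded by blast
  have x0_nz: "x0 \<noteq> 0" using x0(2) P.zero by metis
  define y where "y k = (h ^^ k) x0" for k
  have y_Suc: "y (Suc k) = h (y k)" and y_0: "y 0 = x0" for k
    by (simp_all add: y_def)
  have y_bd: "norm (y k) \<le> C ^ k * norm x0" for k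
  proof (induction k)
    case (Suc k)
    then show ?case using order_trans[OF h(2)[of "y k"] mult_left_mono[OF Suc, of C]] C
      by (simp add: y_Suc mult.assoc)
  qed (simp add: y_0)
  \<comment> \<open>The first bound makes the ratio of the majorant at most 1/2, so the tail after
    \<open>x0\<close> has norm at most \<open>2 * cmod \<mu> * C * norm x0\<close>. The second makes
    the image of this tail under \<open>A ^^ q\<close> smaller than \<open>(A ^^ q) x0\<close>, so
    that the two cannot cancel.\<close>
  define \<delta> where "\<delta> = min (1 / (2 * C)) (norm ((A ^^ q) x0) / (2 * C * norm x0 * B))"
  have "\<delta> > 0" using C B x0 x0_nz by (simp add: \<delta>_def)
  moreover have "\<exists>z. z \<noteq> 0 \<and> A z = \<mu> *\<^sub>C z" if \<mu>: "cmod \<mu> < \<delta>" for \<mu>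
  proof -
    let ?t = "cmod \<mu> * C"
    have t: "0 \<le> ?t" "?t \<le> 1 / 2" "2 * ?t * norm x0 * B < norm ((A ^^ q) x0)"
      using \<mu> C B x0_nz by (simp_all add: \<delta>_def field_simps)
    define w where "w k = \<mu> ^ k *\<^sub>C y k" for k
    have w_bd: "norm (w k) \<le> ?t ^ k * norm x0" for k
      using mult_left_mono[OF y_bd[of k], of "cmod \<mu> ^ k"]
      by (simp add: w_def norm_scaleC norm_power power_mult_distrib mult.assoc)
    have tail_bd: "norm (w (Suc k)) \<le> ?t * norm x0 * (1/2) ^ k" for k
    proof -
      have "?t ^ k * (?t * norm x0) \<le> (1/2) ^ k * (?t * norm x0)"
        using t by (intro mult_right_mono power_mono) simp_all
      then show ?thesis using w_bd[of "Suc k"] by (simp add: algebra_simps)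
    qed
    have "(\<lambda>k. (1/2) ^ k) sums (1 / (1 - 1/2 :: real))" by (intro geometric_sums) simp
    then have geo: "(\<lambda>k. ?t * norm x0 * (1/2) ^ k) sums (2 * ?t * norm x0)"
      using sums_mult[of "\<lambda>k. (1/2) ^ k" 2 "?t * norm x0"] by (simp add: algebra_simps)
    have tail_sm: "summable (\<lambda>k. norm (w (Suc k)))"
      by (rule summable_comparison_test'[OF sums_summable[OF geo]]) (use tail_bd in simp)
    then have sm: "summable w"
      using summable_norm_cancel summable_Suc_iff by blast
    define z where "z = (\<Sum>k. w k)"
    have z: "z = x0 + (\<Sum>k. w (Suc k))"
      using suminf_split_head[OF sm] by (simp add: z_def) (simp add: w_def y_0)
    have "norm (\<Sum>k. w (Suc k)) \<le> (\<Sum>k. norm (w (Suc k)))"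
      by (rule summable_norm[OF tail_sm])
    also have "\<dots> \<le> 2 * ?t * norm x0"
      using suminf_le[OF tail_bd tail_sm sums_summable[OF geo]] sums_unique[OF geo] by simp
    finally have "norm (\<Sum>k. w (Suc k)) * B \<le> 2 * ?t * norm x0 * B"
      using B(1) by (intro mult_right_mono) simp_all
    with B(2) have "norm ((A ^^ q) (\<Sum>k. w (Suc k))) \<le> 2 * ?t * norm x0 * B"
      by (rule order_trans)
    then have "(A ^^ q) z \<noteq> 0"
      using t(3) by (auto simp: z P.add add_eq_0_iff)
    moreover have "(A ^^ Suc q) z = \<mu> *\<^sub>C (A ^^ q) z"
    proof -
      have step: "(A ^^ Suc q) (w (Suc k)) = \<mu> *\<^sub>C (A ^^ q) (w k)" for k
        unfolding w_def y_Suc P(2) h by (simp add: scaleC_scaleC)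
      have "(A ^^ Suc q) z = (A ^^ Suc q) (\<Sum>k. w (Suc k))"
        unfolding z Q.add x0 by simp
      also have "\<dots> = (\<Sum>k. (A ^^ Suc q) (w (Suc k)))"
        by (rule Q.suminf) (rule summable_norm_cancel[OF tail_sm])
      also have "\<dots> = (\<Sum>k. \<mu> *\<^sub>C (A ^^ q) (w k))"
        unfolding step ..
      also have "\<dots> = \<mu> *\<^sub>C (A ^^ q) z"
        unfolding z_def P.suminf[OF sm]
        by (rule bounded_linear.suminf[OF bounded_linear_scaleC P.summable[OF sm], symmetric])
      finally show ?thesis .
    qed
    \<comment> \<open>The eigenvector is \<open>(A ^^ q) z\<close>, not the sum \<open>z\<close>
      itself.\<close>
    ultimately show ?thesis by auto
  qed
  ultimately show ?thesis using that by blast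
qed

section \<open>Eigenvalues in punctured neighbourhoods\<close>

definition eigenvalues :: "('a::complex_banach \<Rightarrow> 'a) \<Rightarrow> complex set"
  where "eigenvalues T = {w. \<exists>x. x \<noteq> 0 \<and> T x = w *\<^sub>C x}"

lemma eigenvalues_shift:
  "w \<in> eigenvalues T \<longleftrightarrow> (\<exists>x. x \<noteq> 0 \<and> T x - z *\<^sub>C x = (w - z) *\<^sub>C x)"
  by (simp add: eigenvalues_def scaleC_diff_left)

text \<open>The neighbourhood must be punctured: stable kernels may be nonzero, in which case
  \<open>z\<close> itself is an eigenvalue.\<close>

lemma eventually_not_eigenvalue:
  assumes T: "T \<in> bounded_ops" and A_def: "A = (\<lambda>x. T x - z *\<^sub>C x)"
    and ran: "range (A ^^ q) \<subseteq> range (A ^^ Suc q)"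
    and ker: "(A ^^ Suc q) -` {0} \<subseteq> (A ^^ q) -` {0}"
  shows "\<forall>\<^sub>F w in at z. w \<notin> eigenvalues T"
proof -
  have A: "A \<in> bounded_ops" unfolding A_def by (rule shift_in_bounded_ops[OF T])
  obtain \<delta> where \<delta>: "\<delta> > 0"
    "\<And>\<mu> x. \<mu> \<noteq> 0 \<Longrightarrow> cmod \<mu> < \<delta> \<Longrightarrow> A x = \<mu> *\<^sub>C x \<Longrightarrow> x = 0"
    using no_small_eigenvalue[OF A ran ker] by metis
  have "w \<notin> eigenvalues T" if "w \<noteq> z" "dist w z < \<delta>" for w
    using \<delta>(2)[of "w - z"] that by (auto simp: eigenvalues_shift[of w T z] A_def dist_norm)
  then show ?thesis using \<delta>(1) unfolding eventually_at by blast
qed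

lemma eventually_eigenvalue:
  assumes T: "T \<in> bounded_ops" and A_def: "A = (\<lambda>x. T x - z *\<^sub>C x)"
    and ran: "range (A ^^ q) \<subseteq> range (A ^^ Suc q)"
    and x0: "(A ^^ Suc q) x0 = 0" "(A ^^ q) x0 \<noteq> 0"
  shows "\<forall>\<^sub>F w in at z. w \<in> eigenvalues T"
proof -
  have A: "A \<in> bounded_ops" unfolding A_def by (rule shift_in_bounded_ops[OF T])
  obtain \<delta> where \<delta>: "\<delta> > 0"
    "\<And>\<mu>. cmod \<mu> < \<delta> \<Longrightarrow> \<exists>x. x \<noteq> 0 \<and> A x = \<mu> *\<^sub>C x"
    using all_small_eigenvalues[OF A ran x0] by metis
  have "w \<in> eigenvalues T" if "dist w z < \<delta>" for w
    using \<delta>(2)[of "w - z"] that by (simp add: eigenvalues_shift[of w T z] A_def dist_norm)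
  then show ?thesis using \<delta>(1) unfolding eventually_at by blast
qed

text \<open>If \<open>P\<close> holds on an open \<open>S\<close> apart from \<open>z\<close>, then
  for any other \<open>y\<close> in \<open>S\<close> the set \<open>S - {z}\<close> is open, as
  points are closed, and serves as a neighbourhood of \<open>y\<close>.\<close>

lemma open_eventually_at: "open {z :: 'a::t1_space. \<forall>\<^sub>F w in at z. P w}"

proof (subst open_subopen, clarsimp)
  fix z :: 'a assume "\<forall>\<^sub>F w in at z. P w"
  then obtain S where S: "open S" "z \<in> S" "\<And>w. w \<in> S \<Longrightarrow> w \<noteq> z \<Longrightarrow> P w"
    unfolding eventually_at_topological by blast
  have "\<forall>\<^sub>F w in at y. P w" if "y \<in> S" for y
  proof (cases "y = z")
    case True
    then show ?thesis using S unfolding eventually_at_topological by blast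
  next
    case False
    then have "open (S - {z})" "y \<in> S - {z}" using S that by auto
    then show ?thesis using S(3) unfolding eventually_at_topological by blast
  qed
  then show "\<exists>U. open U \<and> z \<in> U \<and> U \<subseteq> {z. \<forall>\<^sub>F w in at z. P w}"
    using S by blast
qed

section \<open>Finite descent as range equality and as factorization\<close>

lemma mem_desc_resolvent_iff:
  assumes "T \<in> bounded_ops"
  shows "z \<in> desc_resolvent T \<longleftrightarrow>
    (\<exists>q. range ((\<lambda>x. T x - z *\<^sub>C x) ^^ q) = range ((\<lambda>x. T x - z *\<^sub>C x) ^^ Suc q))"
proof -
  have "linear (\<lambda>x. T x - z *\<^sub>C x)"
    using shift_in_bounded_ops[OF assms] by (simp add: bounded_ops_def bounded_linear.linear)
  from range_funpow_minus[OF this] show ?thesis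
    by (simp add: desc_resolvent_def desc_spectrum_def descent_def del: funpow.simps)
qed

lemma left_mult_funpow: "left_mult A ^^ n = left_mult (A ^^ n)"
  by (induction n) (auto simp: left_mult_def fun_eq_iff)

text \<open>Equality of the two right ideals is tested on the identity, which yields
  \<open>S\<close>. Conversely, composing the factorization with any \<open>R\<close> on the right
  gives one inclusion; the other is \<open>A ^^ Suc q = A ^^ q \<circ> A\<close>.\<close>

lemma not_mem_alg_desc_spectrum_iff:
  assumes "T \<in> bounded_ops" and A_def: "A = (\<lambda>x. T x - z *\<^sub>C x)"
  shows "z \<notin> alg_desc_spectrum T \<longleftrightarrow> (\<exists>q. \<exists>S\<in>bounded_ops. A ^^ q = A ^^ Suc q \<circ> S)"
proof -
  have A: "A \<in> bounded_ops" unfolding A_def by (rule shift_in_bounded_ops) fact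
  have comp: "S \<circ> S' \<in> bounded_ops" if "S \<in> bounded_ops" "S' \<in> bounded_ops"
    for S S' :: "'a \<Rightarrow> 'a"
    using that by (auto simp: bounded_ops_def o_def intro: bounded_linear_compose)
  have "left_mult (A ^^ q) ` bounded_ops = left_mult (A ^^ Suc q) ` bounded_ops \<longleftrightarrow>
      (\<exists>S\<in>bounded_ops. A ^^ q = A ^^ Suc q \<circ> S)" for q
  proof
    assume "left_mult (A ^^ q) ` bounded_ops = left_mult (A ^^ Suc q) ` bounded_ops"
    moreover have "left_mult (A ^^ q) id \<in> left_mult (A ^^ q) ` bounded_ops"
      using bounded_ops_funpow[OF A, of 0] by (intro imageI) (simp add: id_def)
    ultimately show "\<exists>S\<in>bounded_ops. A ^^ q = A ^^ Suc q \<circ> S"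
      by (auto simp: left_mult_def simp del: funpow.simps)
  next
    assume "\<exists>S\<in>bounded_ops. A ^^ q = A ^^ Suc q \<circ> S"
    then obtain S where S: "S \<in> bounded_ops" "A ^^ q = A ^^ Suc q \<circ> S" by blast
    show "left_mult (A ^^ q) ` bounded_ops = left_mult (A ^^ Suc q) ` bounded_ops"
    proof (intro equalityI image_subsetI)
      fix R :: "'a \<Rightarrow> 'a" assume R: "R \<in> bounded_ops"
      have "left_mult (A ^^ q) R = left_mult (A ^^ Suc q) (S \<circ> R)"
        unfolding left_mult_def S(2) by (simp only: comp_assoc)
      then show "left_mult (A ^^ q) R \<in> left_mult (A ^^ Suc q) ` bounded_ops"
        using comp[OF S(1) R] by blast
      have "left_mult (A ^^ Suc q) R = left_mult (A ^^ q) (A \<circ> R)"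
        unfolding left_mult_def funpow_Suc_right by (simp only: comp_assoc)
      then show "left_mult (A ^^ Suc q) R \<in> left_mult (A ^^ q) ` bounded_ops"
        using comp[OF A R] by blast
    qed
  qed
  then show ?thesis
    by (simp add: alg_desc_spectrum_def descent_def left_mult_funpow A_def[symmetric]
        del: funpow.simps)
qed

section \<open>Connectedness and the equality of the spectra\<close>

theorem theorem2:
  fixes T :: "'a::complex_banach \<Rightarrow> 'a"
  assumes "T \<in> bounded_ops"
    and "\<And>G. G \<in> components (desc_resolvent T) \<Longrightarrow> G \<inter> resolvent_set T \<noteq> {}"
  shows "desc_spectrum T = alg_desc_spectrum T"
proof -
  note T = assms(1)
  define U where "U = {z. \<forall>\<^sub>F w in at z. w \<notin> eigenvalues T}"
  define V where "V = {z. \<forall>\<^sub>F w in at z. w \<in> eigenvalues T}"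
  have UV: "U \<inter> V = {}"
  proof -
    \<comment> \<open>No point of the complex plane is isolated, so a property and its negation
      cannot both hold eventually at \<open>z\<close>.\<close>
    have "\<not> ((\<forall>\<^sub>F w in at z. w \<notin> eigenvalues T) \<and> (\<forall>\<^sub>F w in at z. w \<in> eigenvalues T))" for z
      unfolding eventually_conj_iff[symmetric] by simp
    then show ?thesis by (auto simp: U_def V_def)
  qed
  have dichotomy: "z \<in> U \<union> V" if "z \<in> desc_resolvent T" for z
  proof -
    define A where "A = (\<lambda>x. T x - z *\<^sub>C x)"
    obtain q where "range (A ^^ q) = range (A ^^ Suc q)"
      using \<open>z \<in> desc_resolvent T\<close> mem_desc_resolvent_iff[OF T] by (auto simp: A_def)
    then show ?thesis
      using eventually_not_eigenvalue[OF T A_def, of q] eventually_eigenvalue[OF T A_def, of q]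
      unfolding U_def V_def by (cases "(A ^^ Suc q) -` {0} \<subseteq> (A ^^ q) -` {0}") (auto simp del: funpow.simps)
  qed
  have resolvent_U: "z \<in> U" if z: "z \<in> resolvent_set T" for z
  proof -
    define A where "A = (\<lambda>x. T x - z *\<^sub>C x)"
    obtain S where S: "S \<in> bounded_ops" "S \<circ> (\<lambda>x. z *\<^sub>C x - T x) = id"
      "(\<lambda>x. z *\<^sub>C x - T x) \<circ> S = id"
      using z unfolding resolvent_set_def by blast
    have lin: "linear A" "linear S"
      using shift_in_bounded_ops[OF T] S(1) by (auto simp: A_def bounded_ops_def bounded_linear.linear)
    have minus: "(\<lambda>x. z *\<^sub>C x - T x) = (\<lambda>x. - A x)" by (simp add: A_def)
    \<comment> \<open>\<open>S\<close> inverts \<open>z - T\<close>, which is \<open>- A\<close>, so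
      \<open>A\<close> has inverse \<open>- S\<close> and the criterion applies with
      \<open>q = 0\<close>.\<close>
    have AS: "A (- S x) = x" "S (- A x) = x" for x
      using S(2,3) unfolding minus by (simp_all add: fun_eq_iff linear_neg[OF lin(1)])
    have "range (A ^^ 0) \<subseteq> range (A ^^ Suc 0)"
      using AS(1) by (auto intro: range_eqI[OF sym])
    moreover have "(A ^^ Suc 0) -` {0} \<subseteq> (A ^^ 0) -` {0}"
    proof
      fix x assume "x \<in> (A ^^ Suc 0) -` {0}"
      then show "x \<in> (A ^^ 0) -` {0}" using AS(2)[of x] linear_0[OF lin(2)] by simp
    qed
    ultimately show ?thesis
      using eventually_not_eigenvalue[OF T A_def, of 0] unfolding U_def by blast
  qed
  have sub_U: "desc_resolvent T \<subseteq> U"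
  proof
    fix z assume "z \<in> desc_resolvent T"
    then obtain G where G: "G \<in> components (desc_resolvent T)" "z \<in> G"
      using Union_components by blast
    have sub: "G \<subseteq> U \<union> V"
      using dichotomy in_components_subset[OF G(1)] by blast
    have "U \<inter> G \<noteq> {}"
      using assms(2)[OF G(1)] resolvent_U by blast
    \<comment> \<open>\<open>U\<close> and \<open>V\<close> are open and disjoint and cover the
      connected set \<open>G\<close>, so \<open>G\<close> cannot meet both.\<close>
    then have "V \<inter> G = {}"
      using connectedD[OF in_components_connected[OF G(1)], of U V] UV sub open_eventually_at
      unfolding U_def V_def by blast
    then show "z \<in> U" using sub G(2) by blast
  qed
  have "z \<in> desc_resolvent T \<longleftrightarrow> z \<notin> alg_desc_spectrum T" for z
  proof -
    define A where "A = (\<lambda>x. T x - z *\<^sub>C x)"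
    note mem_desc = mem_desc_resolvent_iff[OF T, of z, folded A_def]
    note mem_alg = not_mem_alg_desc_spectrum_iff[OF T A_def]
    show ?thesis
    proof
      assume z: "z \<in> desc_resolvent T"
      then obtain q where q: "range (A ^^ q) = range (A ^^ Suc q)" using mem_desc by blast
      have "z \<notin> V" using z sub_U UV by blast
      \<comment> \<open>A vector violating this inclusion would make every nearby point an
        eigenvalue and so put \<open>z\<close> into \<open>V\<close>.\<close>
      then have "(A ^^ Suc q) -` {0} \<subseteq> (A ^^ q) -` {0}"
        using eventually_eigenvalue[OF T A_def, of q] q unfolding V_def by (auto simp del: funpow.simps)
      from bounded_right_factor[OF shift_in_bounded_ops[OF T, of z, folded A_def] q[symmetric] this]
      obtain S where "S \<in> bounded_ops" "A ^^ q = A ^^ Suc q \<circ> S" .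
      then show "z \<notin> alg_desc_spectrum T" using mem_alg by blast
    next
      assume "z \<notin> alg_desc_spectrum T"
      then obtain q S where "A ^^ q = A ^^ Suc q \<circ> S" using mem_alg by blast
      then have "range (A ^^ q) \<subseteq> range (A ^^ Suc q)" by (auto simp del: funpow.simps)
      moreover have "range (A ^^ Suc q) \<subseteq> range (A ^^ q)"
        unfolding funpow_Suc_right by auto
      ultimately show "z \<in> desc_resolvent T" using mem_desc by blast
    qed
  qed
  then show ?thesis by (auto simp: desc_resolvent_def)
qed

end
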